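(* Let $P_X$ and $P_Y$ be probability distributions on $\mathbb{R}^d$. Then the multivariate Cramér–von Mises distance $W_d(P_X,P_Y)$ is nonnegative, and $$W_d(P_X,P_Y)=0\quad\text{if and only if}\quad P_X=P_Y.$$
   Context: For a random vector $X\sim P_X$ and $\beta\in\mathbb{S}^{d-1}=\{x\in\mathbb{R}^d:\|x\|=1\}$, $F_{\beta^\top X}$ denotes the distribution function of $\beta^\top X$; similarly $F_{\beta^\top Y}$ for $Y\sim P_Y$. Let $\lambda$ be the uniform probability measure on $\mathbb{S}^{d-1}$, let $\vartheta_X\in(0,1)$ be fixed and $\vartheta_Y=1-\vartheta_X$. The multivariate CvM-distance $W_d(P_X,P_Y)$ is the nonnegative square root of $$W_d^2(P_X,P_Y)=\int_{\mathbb{S}^{d-1}}\int_{\mathbb{R}}\big(F_{\beta^\top X}(t)-F_{\beta^\top Y}(t)\big)^2\,dH_\beta(t)\,d\lambda(\beta),\qquad H_\beta(t)=\vartheta_XF_{\beta^\top X}(t)+\vartheta_YF_{\beta^\top Y}(t).$$ *)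

theory Defs
  imports "HOL-Probability.Probability"
begin

text \<open>
  The uniform probability measure on the unit sphere, as the law of the direction \<open>x / norm x\<close> of a
  uniformly distributed point \<open>x\<close> of the open unit ball (\<open>sgn x = x /\<^sub>R norm x\<close> on normed
  spaces; the exceptional value \<open>sgn 0 = 0\<close> is taken with probability \<open>0\<close>).  So the measure of
  a Borel set \<open>A\<close> of directions is the volume of the part of the unit ball in the cone over \<open>A\<close>,
  divided by the volume of the unit ball.
\<close>

definition sphere_uniform :: "'a::euclidean_space measure" where
  "sphere_uniform =
     restrict_space (distr (uniform_measure lborel (ball 0 1)) borel sgn) (sphere 0 1)"

lemma space_sphere_uniform: "space sphere_uniform = sphere 0 1"
  by (simp add: sphere_uniform_def space_restrict_space)

lemma sets_sphere_uniform: "sets sphere_uniform = sets (restrict_space borel (sphere 0 1))"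
  unfolding sphere_uniform_def by (rule sets_restrict_space_cong) simp

lemma emeasure_sphere_uniform:
  fixes A :: "'a::euclidean_space set"
  assumes "A \<in> sets borel" "A \<subseteq> sphere 0 1"
  shows "emeasure sphere_uniform A =
           emeasure lborel (ball 0 1 \<inter> sgn -` A) / emeasure lborel (ball 0 1 :: 'a set)"
proof -
  have m: "sgn -` A \<in> sets borel"
    using measurable_sets[OF borel_measurable_sgn assms(1)] by simp
  have "emeasure sphere_uniform A = emeasure (distr (uniform_measure lborel (ball 0 1)) borel sgn) A"
    unfolding sphere_uniform_def by (rule emeasure_restrict_space) (use assms in auto)
  also have "\<dots> = emeasure (uniform_measure lborel (ball 0 1)) (sgn -` A)"
    by (subst emeasure_distr) (use assms in auto)
  also have "\<dots> = emeasure lborel (ball 0 1 \<inter> sgn -` A) / emeasure lborel (ball 0 1 :: 'a set)"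
    using m by simp
  finally show ?thesis .
qed

lemma prob_space_sphere_uniform: "prob_space (sphere_uniform :: 'a::euclidean_space measure)"
proof
  let ?B = "ball 0 1 :: 'a set"
  have pos: "emeasure lborel ?B \<noteq> 0"
    using content_ball_pos[of 1 "0::'a"] by (auto simp: measure_def)
  have fin: "emeasure lborel ?B \<noteq> \<infinity>"
    using emeasure_bounded_finite[of ?B] by simp
  have eq: "?B \<inter> sgn -` sphere 0 1 = ?B - {0}"
    by (auto simp: norm_sgn)
  have "emeasure (sphere_uniform :: 'a measure) (sphere 0 1) =
      emeasure lborel (?B - {0}) / emeasure lborel ?B"
    by (subst emeasure_sphere_uniform) (auto simp: eq)
  also have "emeasure lborel (?B - {0}) = emeasure lborel ?B"
    by (rule emeasure_Diff_null_set) auto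
  finally show "emeasure (sphere_uniform :: 'a measure) (space sphere_uniform) = 1"
    using pos fin by (simp add: space_sphere_uniform top.not_eq_extremum)
qed

text \<open>Rotation invariance, which characterises the uniform measure among the Borel probability
  measures on the sphere.  (The class \<open>wellorder\<close> on the index type is only needed for
  \<open>measure_orthogonal_image\<close>.)\<close>

lemma emeasure_sphere_uniform_orthogonal:
  fixes f :: "real ^ 'd::{finite,wellorder} \<Rightarrow> real ^ 'd::_" and A :: "(real ^ 'd::_) set"
  assumes f: "orthogonal_transformation f" and A: "A \<in> sets borel" "A \<subseteq> sphere 0 1"
  shows "emeasure sphere_uniform (f ` A) = emeasure sphere_uniform A"
proof -
  let ?S = "ball 0 1 \<inter> sgn -` A"
  obtain g where g: "orthogonal_transformation g" "\<And>x. g (f x) = x" "\<And>y. f (g y) = y"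
    using orthogonal_transformation_inv[OF f] orthogonal_transformation_bij[OF f]
    by (metis bij_inv_eq_iff)
  have fl: "linear f" and gl: "linear g"
    using f g(1) by (auto simp: orthogonal_transformation_linear)
  have fn: "norm (f x) = norm x" "norm (g x) = norm x" for x
    using f g(1) by (auto simp: orthogonal_transformation_norm)
  have img: "f ` T = g -` T" for T
    using g(2,3) by (auto simp: image_iff) (metis)
  have gm: "g \<in> borel_measurable borel"
    using gl by (intro borel_measurable_continuous_onI linear_continuous_on)
      (simp add: linear_conv_bounded_linear)
  have bor: "f ` T \<in> sets borel" if "T \<in> sets borel" for T
    using measurable_sets[OF gm that] by (simp add: img)
  have sg: "sgn (g y) = g (sgn y)" for y
    using gl by (simp add: sgn_div_norm fn linear_scale)
  have S: "?S \<in> sets borel"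
    using measurable_sets[OF borel_measurable_sgn A(1)] by simp
  have fS: "ball 0 1 \<inter> sgn -` (f ` A) = f ` ?S"
    by (auto simp: img fn sg)
  have lb: "?S \<in> lmeasurable"
    using S by (intro bounded_set_imp_lmeasurable bounded_Int) auto
  have "measure lborel (f ` ?S) = measure lborel ?S"
    using measure_orthogonal_image[OF f lb] S bor[OF S] by (simp add: measure_completion)
  moreover have "bounded (f ` ?S)"
    using fl by (intro bounded_linear_image) (auto simp: linear_conv_bounded_linear bounded_Int)
  ultimately have "emeasure lborel (f ` ?S) = emeasure lborel ?S"
    using emeasure_bounded_finite[of ?S] emeasure_bounded_finite[of "f ` ?S"]
    by (simp add: emeasure_eq_ennreal_measure bounded_Int)
  moreover have "f ` A \<subseteq> sphere 0 1"
    using A(2) by (auto simp: fn)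
  ultimately show ?thesis
    using A bor[OF A(1)] by (simp add: emeasure_sphere_uniform fS)
qed

text \<open>The distribution function of \<open>\<beta> \<bullet> X\<close> for a random vector \<open>X\<close> with law \<open>P\<close>.\<close>

definition proj_cdf :: "(real ^ 'd) measure \<Rightarrow> real ^ 'd \<Rightarrow> real \<Rightarrow> real" where
  "proj_cdf P \<beta> = cdf (distr P borel (\<lambda>x. \<beta> \<bullet> x))"

definition mixed_cdf :: "real \<Rightarrow> (real ^ 'd) measure \<Rightarrow> (real ^ 'd) measure \<Rightarrow> real ^ 'd \<Rightarrow> real \<Rightarrow> real" where
  "mixed_cdf \<theta> P Q \<beta> t = \<theta> * proj_cdf P \<beta> t + (1 - \<theta>) * proj_cdf Q \<beta> t"

text \<open>The parameter \<open>\<theta>\<close> is the weight of \<open>P\<close>, and \<open>interval_measure H\<close> is the Lebesgue--Stieltjes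
  measure \<open>dH\<close>.\<close>

definition cvm_distance :: "real \<Rightarrow> (real ^ 'd) measure \<Rightarrow> (real ^ 'd) measure \<Rightarrow> real" where
  "cvm_distance \<theta> P Q =
     sqrt (LINT \<beta>|sphere_uniform. LINT t|interval_measure (mixed_cdf \<theta> P Q \<beta>).
       (proj_cdf P \<beta> t - proj_cdf Q \<beta> t)\<^sup>2)"

end

theory Submission
  imports Defs
begin

text \<open>
  If the distance vanishes, then for almost every direction \<open>\<beta>\<close> the distribution functions of the
  two projections agree almost everywhere for their mixture.  Both are constant on intervals that are
  null for the mixture, so they agree everywhere, and the projections have the same law.  Hence
  \<open>\<integral> cos (u \<bullet> x + c)\<close> is the same for both laws when \<open>u\<close> is a multiple of almost any direction, and
  by continuity in \<open>u\<close> for every \<open>u\<close>.  The trigonometric polynomials form an algebra that separates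
  points, so Stone--Weierstrass on a large ball shows that the two laws agree.
\<close>

subsection \<open>The Cramer--Wold theorem\<close>

text \<open>The free phase \<open>c\<close> covers sines and cosines by one real generator;
  \<open>u = 0\<close> gives the constants. Sums of such terms are already closed under products, so
  no multiplication rule is included.\<close>

inductive trig_polynomial :: "('a::real_inner \<Rightarrow> real) \<Rightarrow> bool" where
  cosine: "trig_polynomial (\<lambda>x. a * cos (u \<bullet> x + c))"
| add: "trig_polynomial f \<Longrightarrow> trig_polynomial g \<Longrightarrow> trig_polynomial (\<lambda>x. f x + g x)"

lemma trig_polynomial_const: "trig_polynomial (\<lambda>x. c)"
  using trig_polynomial.cosine[of c 0 0] by simp

text \<open>Product-to-sum formula 2 cos p cos q = cos (p - q) + cos (p + q) for single cosines,
  extended to sums by induction on each factor.\<close>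

lemma trig_polynomial_mult:
  assumes "trig_polynomial f" and g: "trig_polynomial g"
  shows "trig_polynomial (\<lambda>x. f x * g x)"
  using assms(1)
proof induction
  case (cosine a u c)
  show ?case using g
  proof induction
    case (cosine b v d)
    have "(\<lambda>x. a * cos (u \<bullet> x + c) * (b * cos (v \<bullet> x + d))) =
        (\<lambda>x. (a * b / 2) * cos ((u - v) \<bullet> x + (c - d)) + (a * b / 2) * cos ((u + v) \<bullet> x + (c + d)))"
    proof
      fix x
      have eq: "(u - v) \<bullet> x + (c - d) = (u \<bullet> x + c) - (v \<bullet> x + d)"
        "(u + v) \<bullet> x + (c + d) = (u \<bullet> x + c) + (v \<bullet> x + d)"
        by (simp_all add: inner_simps)
      show "a * cos (u \<bullet> x + c) * (b * cos (v \<bullet> x + d)) =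
        (a * b / 2) * cos ((u - v) \<bullet> x + (c - d)) + (a * b / 2) * cos ((u + v) \<bullet> x + (c + d))"
        unfolding eq cos_add[of "u \<bullet> x + c" "v \<bullet> x + d"] cos_diff[of "u \<bullet> x + c" "v \<bullet> x + d"]
        by (simp add: field_simps)
    qed
    then show ?case by (simp only:) (intro trig_polynomial.intros)
  next
    case (add g h)
    then show ?case by (simp add: distrib_left trig_polynomial.add)
  qed
next
  case (add f h)
  then show ?case by (simp add: distrib_right trig_polynomial.add)
qed

lemma continuous_on_trig_polynomial:
  "trig_polynomial f \<Longrightarrow> continuous_on A f"
  by (induction rule: trig_polynomial.induct) (auto intro!: continuous_intros)

lemma trig_polynomial_bounded:
  "trig_polynomial f \<Longrightarrow> \<exists>M. \<forall>x. \<bar>f x\<bar> \<le> M"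
proof (induction rule: trig_polynomial.induct)
  case (cosine a u c)
  have "\<bar>a * cos (u \<bullet> x + c)\<bar> \<le> \<bar>a\<bar>" for x
    by (simp add: abs_mult mult_left_le)
  then show ?case by blast
next
  case (add f g)
  then obtain M N where "\<And>x. \<bar>f x\<bar> \<le> M" "\<And>x. \<bar>g x\<bar> \<le> N" by blast
  then have "\<bar>f x + g x\<bar> \<le> M + N" for x
    by (meson abs_triangle_ineq add_mono order_trans)
  then show ?case by blast
qed

lemma trig_polynomial_compose_polynomial:
  assumes "real_polynomial_function p" and f: "trig_polynomial f"
  shows "trig_polynomial (\<lambda>x. p (f x))"
  using assms(1)
proof induction
  case (linear h)
  then obtain c where "h = (\<lambda>x. x * c)"
    using real_bounded_linear by blast
  then show ?case
    using trig_polynomial_mult[OF f trig_polynomial_const] by simp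
next
  case (const c)
  then show ?case by (rule trig_polynomial_const)
next
  case (add p q)
  then show ?case by (intro trig_polynomial.add)
next
  case (mult p q)
  then show ?case by (intro trig_polynomial_mult)
qed

lemma function_ring_on_trig_polynomial:
  fixes S :: "'a::euclidean_space set"
  assumes "compact S"
  shows "function_ring_on (Collect trig_polynomial) S"
proof
  fix x y :: 'a
  assume "x \<noteq> y"
  \<comment> \<open>Scaled so that \<open>?u \<bullet> (x - y) = 1\<close>; with the phase
    \<open>- (?u \<bullet> y)\<close> the cosine is 1 at \<open>y\<close> and
    \<open>cos 1 < 1\<close> at \<open>x\<close>.\<close>
  let ?u = "(x - y) /\<^sub>R (norm (x - y))\<^sup>2"
  let ?f = "\<lambda>z. 1 * cos (?u \<bullet> z + - (?u \<bullet> y))"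
  have "?u \<bullet> x + - (?u \<bullet> y) = ?u \<bullet> (x - y)"
    by (simp add: inner_diff_right)
  also have "\<dots> = 1"
    using \<open>x \<noteq> y\<close> by (simp add: power2_norm_eq_inner)
  finally have "?f x = cos 1" by simp
  moreover have "?f y = 1" by simp
  moreover have "cos 1 < (1::real)"
    using cos_monotone_0_pi[of 0 1] pi_gt3 by simp
  ultimately have "?f x \<noteq> ?f y" by simp
  then show "\<exists>f\<in>Collect trig_polynomial. f x \<noteq> f y"
    using trig_polynomial.cosine[of 1 ?u "- (?u \<bullet> y)"] by (intro bexI[of _ ?f]) simp_all
qed (use assms in \<open>auto intro: continuous_on_trig_polynomial trig_polynomial.add
    trig_polynomial_mult trig_polynomial_const\<close>)

text \<open>The bound on \<open>h\<close> over the whole space does not depend on \<open>S\<close>;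
  it keeps the integral over the complement of a large ball small.\<close>

lemma trig_polynomial_approx:
  fixes f :: "'a::euclidean_space \<Rightarrow> real"
  assumes "compact S" and "continuous_on S f" and f: "\<And>x. x \<in> S \<Longrightarrow> \<bar>f x\<bar> \<le> 1" and "0 < e"
  obtains h where "trig_polynomial h" "\<And>x. x \<in> S \<Longrightarrow> \<bar>f x - h x\<bar> < e" "\<And>x. \<bar>h x\<bar> < 1 + e"
proof -
  interpret function_ring_on "Collect trig_polynomial" S
    using \<open>compact S\<close> by (rule function_ring_on_trig_polynomial)
  from \<open>0 < e\<close> have e2: "0 < e / 2" by simp
  obtain g where g: "trig_polynomial g" "\<And>x. x \<in> S \<Longrightarrow> \<bar>f x - g x\<bar> < e / 2"
    using Stone_Weierstrass_basic[OF \<open>continuous_on S f\<close> e2] by auto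
  obtain M where M: "\<And>x. \<bar>g x\<bar> \<le> M"
    using trig_polynomial_bounded[OF g(1)] by blast
  \<comment> \<open>The approximation is only controlled on \<open>S\<close>; composing with a polynomial close to the
     truncation at \<open>\<plusminus>1\<close> bounds it everywhere.\<close>
  let ?c = "\<lambda>y::real. max (-1) (min 1 y)"
  have "continuous_on {-M..M} ?c"
    by (intro continuous_intros)
  then obtain p where p: "real_polynomial_function p"
      "\<And>y. y \<in> {-M..M} \<Longrightarrow> \<bar>?c y - p y\<bar> < e / 2"
    using Stone_Weierstrass_real_polynomial_function[of "{-M..M}" ?c "e/2"] e2 by auto
  have pg: "\<bar>?c (g x) - p (g x)\<bar> < e / 2" for x
    using p(2)[of "g x"] M[of x] by (simp add: abs_le_iff)
  show thesis
  proof
    show "trig_polynomial (\<lambda>x. p (g x))"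
      using p(1) g(1) by (rule trig_polynomial_compose_polynomial)
    \<comment> \<open>The truncation is 1-Lipschitz and fixes \<open>f x\<close>, which lies in
      [-1, 1], so truncating \<open>g x\<close> does not increase its distance to
      \<open>f x\<close>. Each of the two approximations costs \<open>e / 2\<close>.\<close>
    show "\<bar>f x - p (g x)\<bar> < e" if "x \<in> S" for x
      using pg[of x] g(2)[OF that] f[OF that] unfolding max_def min_def by argo
    show "\<bar>p (g x)\<bar> < 1 + e" for x
      using pg[of x] \<open>0 < e\<close> unfolding max_def min_def by argo
  qed
qed

section \<open>Laws determined by their integrals\<close>

lemma integrable_trig_polynomial:
  fixes f :: "'a::euclidean_space \<Rightarrow> real"
  assumes "finite_measure M" and sets: "sets M = sets borel" and f: "trig_polynomial f"
  shows "integrable M f"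
proof -
  interpret finite_measure M by fact
  obtain B where "\<And>x. \<bar>f x\<bar> \<le> B"
    using trig_polynomial_bounded[OF f] by blast
  moreover have "f \<in> borel_measurable M"
    using borel_measurable_continuous_onI[OF continuous_on_trig_polynomial[OF f]]
    by (simp add: measurable_cong_sets[OF sets refl])
  ultimately show ?thesis
    by (intro integrable_const_bound[of _ B]) auto
qed

text \<open>By linearity the two laws agree on trigonometric polynomials. One of these approximates
  \<open>f\<close> on a ball carrying nearly all the mass of both laws, and its global bound
  controls the rest.\<close>

lemma integral_eq_if_cos_integral_eq:
  fixes P Q :: "'a::euclidean_space measure" and f :: "'a \<Rightarrow> real"
  assumes P: "prob_space P" "sets P = sets borel"
    and Q: "prob_space Q" "sets Q = sets borel"
    and eq: "\<And>u c. (LINT x|P. cos (u \<bullet> x + c)) = (LINT x|Q. cos (u \<bullet> x + c))"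
    and f: "continuous_on UNIV f" "\<And>x. \<bar>f x\<bar> \<le> 1"
  shows "integral\<^sup>L P f = integral\<^sup>L Q f"
proof -
  have trig_eq: "integral\<^sup>L P h = integral\<^sup>L Q h" if "trig_polynomial h" for h
    using that
  proof induction
    case (cosine a u c)
    show ?case by (simp add: eq)
  next
    case (add g h)
    have "integrable M g" "integrable M h"
      if "prob_space M" "sets M = sets borel" for M
      using add.hyps that
      by (auto simp: prob_space_def intro!: integrable_trig_polynomial)
    with P Q add.IH show ?case by simp
  qed
  \<comment> \<open>Tightness of a single law: the complements of the balls decrease to the empty
    set.\<close>
  have tail: "\<forall>\<^sub>F n in sequentially. measure M (- cball 0 (real n)) < e"
    if M: "prob_space M" "sets M = sets borel" and "0 < e" for M :: "'a measure" and e
  proof -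
    interpret prob_space M by fact
    have "(\<lambda>n. measure M (- cball 0 (real n))) \<longlonglongrightarrow> measure M (\<Inter>n. - cball 0 (real n))"
    proof (rule finite_Lim_measure_decseq)
      have "- cball 0 (real n) \<in> sets M" for n
        unfolding M(2) by (intro borel_open open_Compl closed_cball)
      then show "range (\<lambda>n. - cball 0 (real n)) \<subseteq> sets M"
        by blast
      show "decseq (\<lambda>n. - cball 0 (real n) :: 'a set)"
        unfolding decseq_def by (intro allI impI Compl_anti_mono subset_cball) simp
    qed
    also have "(\<Inter>n. - cball 0 (real n)) = ({} :: 'a set)"
      by (simp add: set_eq_iff not_less real_arch_simple)
    finally show ?thesis
      using \<open>0 < e\<close> order_tendstoD(2) by fastforce
  qed
  \<comment> \<open>The difference of \<open>f\<close> and \<open>h\<close> is below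
    \<open>e\<close> on \<open>K\<close> and below \<open>1 + (1 + e) = 2 + e\<close> off
    \<open>K\<close>. The bound on the mass of \<open>- K\<close> makes the second contribution less
    than \<open>e\<close>; the total is at most \<open>2 * e\<close>, and \<open>3 * e\<close>
    leaves slack.\<close>
  have approx: "\<bar>integral\<^sup>L M f - integral\<^sup>L M h\<bar> \<le> 3 * e"
    if M: "prob_space M" "sets M = sets borel" and h: "trig_polynomial h"
      "\<And>x. x \<in> K \<Longrightarrow> \<bar>f x - h x\<bar> < e" "\<And>x. \<bar>h x\<bar> < 1 + e"
      and K: "closed K" "measure M (- K) < e / (2 + e)" and "0 < e"
    for M h K e
  proof -
    interpret prob_space M by fact
    have [measurable]: "- K \<in> sets M"
      using K(1) M(2) by auto
    have fm: "f \<in> borel_measurable M"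
      using borel_measurable_continuous_onI[OF f(1)] by (simp add: measurable_cong_sets[OF M(2) refl])
    have fi: "integrable M f"
      using f(2) fm by (intro integrable_const_bound[of _ 1]) auto
    have hi: "integrable M h"
      using finite_measure_axioms M(2) h(1) by (rule integrable_trig_polynomial)
    have ki: "integrable M (\<lambda>x. e + (2 + e) * indicator (- K) x)"
      by (intro Bochner_Integration.integrable_add integrable_mult_right integrable_const
          integrable_real_indicator) (auto simp: emeasure_eq_measure)
    have "\<bar>integral\<^sup>L M f - integral\<^sup>L M h\<bar> = \<bar>LINT x|M. f x - h x\<bar>"
      using fi hi by simp
    also have "\<dots> \<le> (LINT x|M. \<bar>f x - h x\<bar>)"
      using integral_abs_bound .
    also have "\<dots> \<le> (LINT x|M. e + (2 + e) * indicator (- K) x)"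
    proof (rule integral_mono[OF _ ki])
      show "integrable M (\<lambda>x. \<bar>f x - h x\<bar>)" using fi hi by simp
      show "\<bar>f x - h x\<bar> \<le> e + (2 + e) * indicator (- K) x" for x
        using h(2)[of x] h(3)[of x] f(2)[of x] \<open>0 < e\<close> by (auto simp: indicator_def)
    qed
    also have "\<dots> = e + (2 + e) * measure M (- K)"
      using sets.sets_into_space[OF \<open>- K \<in> sets M\<close>]
      by (subst Bochner_Integration.integral_add)
        (auto simp: prob_space emeasure_eq_measure Int_absorb2
          intro!: integrable_mult_right integrable_real_indicator)
    also have "\<dots> \<le> 3 * e"
      using K(2) \<open>0 < e\<close> by (simp add: field_simps)
    finally show ?thesis .
  qed
  have "\<bar>integral\<^sup>L P f - integral\<^sup>L Q f\<bar> \<le> e" if "0 < e" for e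
  proof -
    \<comment> \<open>Each law contributes an error of at most \<open>3 * d\<close>, so the two
      together give \<open>e\<close>.\<close>
    define d where "d = e / 6"
    have "0 < d" "0 < d / (2 + d)" using that by (auto simp: d_def)
    then have "\<forall>\<^sub>F n in sequentially. measure P (- cball 0 (real n)) < d / (2 + d) \<and>
        measure Q (- cball 0 (real n)) < d / (2 + d)"
      using tail[OF P] tail[OF Q] by (intro eventually_conj) auto
    then obtain n where n: "measure P (- cball 0 (real n)) < d / (2 + d)"
        "measure Q (- cball 0 (real n)) < d / (2 + d)"
      by (auto simp: eventually_sequentially)
    obtain h where h: "trig_polynomial h" "\<And>x. x \<in> cball 0 (real n) \<Longrightarrow> \<bar>f x - h x\<bar> < d"
        "\<And>x. \<bar>h x\<bar> < 1 + d"
      by (rule trig_polynomial_approx[OF compact_cball[of 0 "real n"]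
            continuous_on_subset[OF f(1) subset_UNIV] f(2) \<open>0 < d\<close>]) (rule that; blast)
    have "\<bar>integral\<^sup>L P f - integral\<^sup>L P h\<bar> \<le> 3 * d" "\<bar>integral\<^sup>L Q f - integral\<^sup>L Q h\<bar> \<le> 3 * d"
      by (rule approx[OF P h _ n(1) \<open>0 < d\<close>] approx[OF Q h _ n(2) \<open>0 < d\<close>]; simp)+
    then show ?thesis
      using trig_eq[OF h(1)] unfolding d_def by argo
  qed
  then show ?thesis
    using field_le_epsilon[of "\<bar>integral\<^sup>L P f - integral\<^sup>L Q f\<bar>" 0] by simp
qed

text \<open>Indicators of closed sets are pointwise limits of bounded continuous functions, and the
  closed sets are an intersection-stable generator of the Borel sets.\<close>

lemma measure_eqI_bounded_continuous:
  fixes P Q :: "'a::metric_space measure"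
  assumes P: "finite_measure P" "sets P = sets borel"
    and Q: "finite_measure Q" "sets Q = sets borel"
    and eq: "\<And>f::'a \<Rightarrow> real. continuous_on UNIV f \<Longrightarrow> (\<And>x. \<bar>f x\<bar> \<le> 1) \<Longrightarrow> integral\<^sup>L P f = integral\<^sup>L Q f"
  shows "P = Q"
proof (rule measure_eqI_generator_eq[of "Collect closed" UNIV _ _ "\<lambda>_. UNIV"])
  fix C :: "'a set"
  assume "C \<in> Collect closed"
  then have C: "closed C" by simp
  show "emeasure P C = emeasure Q C"
  \<comment> \<open>The distance to the empty set is 0 by convention, so \<open>f n\<close> below
    would be constantly 1 for empty \<open>C\<close>. For nonempty \<open>C\<close> it is 1 on
    \<open>C\<close> and falls linearly to 0 at distance \<open>1 / n\<close>.\<close>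
  proof (cases "C = {}")
    case False
    define f :: "nat \<Rightarrow> 'a \<Rightarrow> real" where "f n x = max 0 (1 - real n * infdist x C)" for n x
    have f_bd: "\<bar>f n x\<bar> \<le> 1" for n x
      using infdist_nonneg[of x C] by (auto simp: f_def max_def)
    have f_cont: "continuous_on UNIV (f n)" for n
      unfolding f_def by (intro continuous_intros)
    have f_lim: "(\<lambda>n. f n x) \<longlonglongrightarrow> indicator C x" for x
    proof (cases "x \<in> C")
      case True
      then show ?thesis by (simp add: f_def)
    next
      case x: False
      then have "0 < infdist x C"
        using in_closed_iff_infdist_zero[OF C False, of x] infdist_nonneg[of x C] by auto
      then obtain N where "1 < real N * infdist x C"
        using ex_less_of_nat_mult by blast
      then have "f n x = 0" if "N \<le> n" for n
        using that \<open>0 < infdist x C\<close> mult_right_mono[of "real N" "real n" "infdist x C"]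
        unfolding f_def by (intro max_absorb1) linarith
      then have "\<forall>\<^sub>F n in sequentially. f n x = 0"
        by (auto simp: eventually_sequentially)
      then show ?thesis
        using x by (simp add: tendsto_eventually)
    qed
    have lim: "(\<lambda>n. integral\<^sup>L M (f n)) \<longlonglongrightarrow> measure M C"
      if M: "finite_measure M" "sets M = sets borel" for M
    proof -
      interpret finite_measure M by fact
      have [measurable]: "C \<in> sets M" using C M(2) by auto
      have [measurable]: "f n \<in> borel_measurable M" for n
        using borel_measurable_continuous_onI[OF f_cont] by (simp add: measurable_cong_sets[OF M(2) refl])
      have "(\<lambda>n. integral\<^sup>L M (f n)) \<longlonglongrightarrow> (LINT x|M. indicator C x :: real)"
        by (rule integral_dominated_convergence[of _ _ _ "\<lambda>_. 1"]) (use f_lim f_bd in auto)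
      moreover have "C \<inter> space M = C"
        using sets.sets_into_space[of C M] by auto
      ultimately show ?thesis by simp
    qed
    have "measure P C = measure Q C"
      using lim[OF P] lim[OF Q] eq[OF f_cont f_bd] by (simp add: LIMSEQ_unique)
    then show ?thesis
      using P(1) Q(1) by (simp add: finite_measure.emeasure_eq_measure)
  qed simp
next
  show "sets P = sigma_sets UNIV (Collect closed)" "sets Q = sigma_sets UNIV (Collect closed)"
    using P(2) Q(2) by (simp_all add: borel_eq_closed)
qed (use P(1) in \<open>auto simp: Int_stable_def finite_measure.emeasure_finite\<close>)

section \<open>From almost every direction to the whole law\<close>

lemma continuous_on_cos_integral:
  fixes M :: "'a::euclidean_space measure"
  assumes M: "finite_measure M" and sets: "sets M = sets borel"
  shows "continuous_on A (\<lambda>u. LINT x|M. cos (u \<bullet> x + c))"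
  unfolding continuous_on_sequentially comp_def
proof (intro allI ballI impI)
  interpret finite_measure M by fact
  fix v u assume "u \<in> A" and "(\<forall>n. v n \<in> A) \<and> v \<longlonglongrightarrow> u"
  then have v: "v \<longlonglongrightarrow> u" by simp
  have m: "(\<lambda>x. cos (w \<bullet> x + c)) \<in> borel_measurable M" for w :: 'a
    unfolding measurable_cong_sets[OF sets refl]
    by (intro borel_measurable_continuous_onI continuous_intros)
  show "(\<lambda>n. LINT x|M. cos (v n \<bullet> x + c)) \<longlonglongrightarrow> (LINT x|M. cos (u \<bullet> x + c))"
    by (rule integral_dominated_convergence[of _ _ _ "\<lambda>_. 1"])
      (use m v in \<open>auto intro!: tendsto_intros\<close>)
qed

text \<open>Equality of cosine integrals is a closed condition on the frequency vector, and a closed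
  set containing almost every point of the ball contains all of it. This turns almost every
  direction into every direction.\<close>

lemma Cramer_Wold_AE:
  fixes P Q :: "'a::euclidean_space measure"
  assumes P: "prob_space P" "sets P = sets borel"
    and Q: "prob_space Q" "sets Q = sets borel"
    and AE: "AE \<beta> in sphere_uniform. distr P borel (\<lambda>x. \<beta> \<bullet> x) = distr Q borel (\<lambda>x. \<beta> \<bullet> x)"
  shows "P = Q"
proof (rule measure_eqI_bounded_continuous[OF _ P(2) _ Q(2)])
  \<comment> \<open>\<open>J M c u\<close> is the real part of exp(ic) times the characteristic
    function of \<open>M\<close> at \<open>u\<close>.\<close>
  define J where "J M c u = (LINT x|M. cos (u \<bullet> x + c))" for M :: "'a measure" and c u
  have J_cont: "continuous_on A (J P c)" "continuous_on A (J Q c)" for A c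
    unfolding J_def using P Q by (auto simp: prob_space_def intro!: continuous_on_cos_integral)
  \<comment> \<open>Quantifying over all multiples \<open>r\<close> makes \<open>C\<close> a cone:
    membership of a nonzero \<open>u\<close> depends on its line only, and information on the unit
    ball reaches every vector.\<close>
  define C where "C = {u. \<forall>r c. J P c (r *\<^sub>R u) = J Q c (r *\<^sub>R u)}"
  have "closed C"
    unfolding C_def
    by (intro closed_Collect_all closed_Collect_eq continuous_on_compose2[OF J_cont(1)[of UNIV]]
        continuous_on_compose2[OF J_cont(2)[of UNIV]] continuous_intros) auto
  have inner_measurable: "(\<lambda>x. u \<bullet> x) \<in> borel_measurable M" if "sets M = sets borel" for M u
    unfolding measurable_cong_sets[OF that refl]
    by (intro borel_measurable_continuous_onI continuous_intros)
  have J_distr: "J M c (r *\<^sub>R u) = (LINT t|distr M borel (\<lambda>x. u \<bullet> x). cos (r * t + c))"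
    if "sets M = sets borel" for M c r u
    unfolding J_def using inner_measurable[OF that, of u]
    by (subst integral_distr) auto
  \<comment> \<open>The implication accommodates \<open>u = 0\<close>, where
    \<open>sgn u = 0\<close> is off the sphere; there both integrals equal
    \<open>cos c\<close>.\<close>
  have good: "u \<in> C"
    if "sgn u \<in> sphere 0 1 \<longrightarrow> distr P borel (\<lambda>x. sgn u \<bullet> x) = distr Q borel (\<lambda>x. sgn u \<bullet> x)" for u
  proof (cases "u = 0")
    case True
    then show ?thesis
      using P(1) Q(1) by (simp add: C_def J_def prob_space.prob_space)
  next
    case False
    then have "distr P borel (\<lambda>x. sgn u \<bullet> x) = distr Q borel (\<lambda>x. sgn u \<bullet> x)"
      using that by (simp add: norm_sgn)
    then have "J P c (r *\<^sub>R sgn u) = J Q c (r *\<^sub>R sgn u)" for r c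
      by (simp add: J_distr P(2) Q(2))
    then have "J P c ((r * norm u) *\<^sub>R sgn u) = J Q c ((r * norm u) *\<^sub>R sgn u)" for r c
      by blast
    moreover have "(r * norm u) *\<^sub>R sgn u = r *\<^sub>R u" for r
      using False by (simp add: sgn_div_norm)
    ultimately show ?thesis
      by (simp add: C_def)
  qed
  let ?B = "ball 0 1 :: 'a set"
  have pos: "emeasure lborel ?B \<noteq> 0"
    using content_ball_pos[of 1 "0::'a"] by (auto simp: measure_def)
  have fin: "emeasure lborel ?B < \<infinity>"
    using emeasure_bounded_finite[of ?B] by simp
  \<comment> \<open>As \<open>sphere_uniform\<close> is the law of \<open>sgn u\<close> for
    \<open>u\<close> uniform in the ball, the statement on directions pulls back to almost every
    point of the ball.\<close>
  have "AE \<beta> in distr (uniform_measure lborel ?B) borel sgn. \<beta> \<in> sphere 0 1 \<longrightarrow>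
      distr P borel (\<lambda>x. \<beta> \<bullet> x) = distr Q borel (\<lambda>x. \<beta> \<bullet> x)"
    using AE unfolding sphere_uniform_def by (subst (asm) AE_restrict_space_iff) auto
  then have "AE u in uniform_measure lborel ?B. sgn u \<in> sphere 0 1 \<longrightarrow>
      distr P borel (\<lambda>x. sgn u \<bullet> x) = distr Q borel (\<lambda>x. sgn u \<bullet> x)"
    by (rule AE_distrD[rotated]) simp
  then have "AE u in uniform_measure lborel ?B. u \<in> C"
    by (rule eventually_mono) (use good in auto)
  then have "AE u \<in> ?B in lebesgue. u \<in> C"
    unfolding AE_uniform_measure[OF pos fin] by (rule AE_completion)
  \<comment> \<open>The part of the open ball outside the closed set \<open>C\<close> is open and
    null, hence empty.\<close>
  then have ball: "u \<in> C" if "u \<in> ?B" for u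
    using mem_closed_if_AE_lebesgue_open[OF open_ball \<open>closed C\<close>] that by blast
  have "J P c u = J Q c u" for c u
  proof -
    \<comment> \<open>Dividing by \<open>1 + norm u\<close> moves \<open>u\<close> into the open
      unit ball; the multiple \<open>r = 1 + norm u\<close> in the definition of \<open>C\<close>
      moves it back.\<close>
    have "0 < 1 + norm u"
      using norm_ge_zero[of u] by linarith
    then have "u /\<^sub>R (1 + norm u) \<in> ?B"
      by (simp add: field_simps)
    from ball[OF this] have "J P c ((1 + norm u) *\<^sub>R (u /\<^sub>R (1 + norm u))) =
        J Q c ((1 + norm u) *\<^sub>R (u /\<^sub>R (1 + norm u)))"
      unfolding C_def by blast
    with \<open>0 < 1 + norm u\<close> show ?thesis by simp
  qed
  then show "integral\<^sup>L P f = integral\<^sup>L Q f"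
    if "continuous_on UNIV f" "\<And>x. \<bar>f x\<bar> \<le> 1" for f :: "'a \<Rightarrow> real"
    using integral_eq_if_cos_integral_eq[OF P Q _ that] by (simp add: J_def)
qed (use P(1) Q(1) in \<open>auto simp: prob_space_def\<close>)

subsection \<open>Distribution functions that agree almost everywhere\<close>

text \<open>Suppose the functions differ at \<open>t\<close>. The points up to \<open>t\<close>
  where they agree carry all the mass of \<open>M\<close> on \<open>{..t}\<close>, yet at each of
  them \<open>cdf M\<close> lies below \<open>cdf M t\<close> by a fixed amount. Approaching their
  supremum is contradictory.\<close>

lemma cdf_eq_if_AE_mixture:
  assumes \<mu>: "real_distribution \<mu>" and \<nu>: "real_distribution \<nu>" and M: "real_distribution M"
    and \<theta>: "0 < \<theta>" "\<theta> < 1"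
    and mix: "\<And>t. cdf M t = \<theta> * cdf \<mu> t + (1 - \<theta>) * cdf \<nu> t"
    and AE: "AE t in M. cdf \<mu> t = cdf \<nu> t"
  shows "cdf \<mu> = cdf \<nu>"
proof (rule ext, rule ccontr)
  fix t
  assume neq: "cdf \<mu> t \<noteq> cdf \<nu> t"
  interpret \<mu>: real_distribution \<mu> by fact
  interpret \<nu>: real_distribution \<nu> by fact
  interpret M: real_distribution M by fact
  define A where "A = {s. s \<le> t \<and> cdf \<mu> s = cdf \<nu> s}"
  have [measurable]: "cdf \<mu> \<in> borel_measurable borel" "cdf \<nu> \<in> borel_measurable borel"
    by (auto intro!: borel_measurable_mono monoI \<mu>.cdf_nondecreasing \<nu>.cdf_nondecreasing)
  have A_sets: "A \<in> sets borel"
    unfolding A_def by measurable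
  have "measure M A = measure M {..t}"
    using AE A_sets by (intro M.finite_measure_eq_AE) (auto simp: A_def)
  then have A: "measure M A = cdf M t"
    by (simp add: cdf_def)
  \<comment> \<open>The functions agree at \<open>s\<close>, so their difference at \<open>t\<close>
    is \<open>?a - ?b\<close>, at most \<open>?a + ?b\<close> in absolute value; the mixture weights
    both increments by at least \<open>min \<theta> (1 - \<theta>)\<close>.\<close>
  have gap: "min \<theta> (1 - \<theta>) * \<bar>cdf \<mu> t - cdf \<nu> t\<bar> \<le> cdf M t - cdf M s" if "s \<in> A" for s
  proof -
    let ?a = "cdf \<mu> t - cdf \<mu> s" and ?b = "cdf \<nu> t - cdf \<nu> s"
    have nn: "0 \<le> ?a" "0 \<le> ?b"
      using that \<mu>.cdf_nondecreasing[of s t] \<nu>.cdf_nondecreasing[of s t] by (simp_all add: A_def)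
    have "min \<theta> (1 - \<theta>) * \<bar>cdf \<mu> t - cdf \<nu> t\<bar> \<le> min \<theta> (1 - \<theta>) * (?a + ?b)"
      using that nn \<theta> by (intro mult_left_mono) (auto simp: A_def)
    also have "\<dots> \<le> \<theta> * ?a + (1 - \<theta>) * ?b"
      unfolding distrib_left using nn by (intro add_mono mult_right_mono) auto
    also have "\<dots> = cdf M t - cdf M s"
      by (simp add: mix algebra_simps)
    finally show ?thesis .
  qed
  define e where "e = min \<theta> (1 - \<theta>) * \<bar>cdf \<mu> t - cdf \<nu> t\<bar>"
  have "0 < e" using neq \<theta> by (simp add: e_def)
  have gap: "cdf M s + e \<le> cdf M t" if "s \<in> A" for s
    using gap[OF that] by (simp add: e_def)
  \<comment> \<open>Since \<open>measure M A = cdf M t\<close>, this makes \<open>A\<close> nonempty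
    and \<open>Sup A\<close> meaningful.\<close>
  have pos: "0 < cdf M t"
  proof -
    have "0 < cdf \<mu> t \<or> 0 < cdf \<nu> t"
      using neq \<mu>.cdf_nonneg[of t] \<nu>.cdf_nonneg[of t] by linarith
    then show ?thesis
      using \<theta> \<mu>.cdf_nonneg[of t] \<nu>.cdf_nonneg[of t] unfolding mix
      by (auto intro: add_pos_nonneg add_nonneg_pos)
  qed
  have "A \<noteq> {}" using A pos by auto
  have bdd: "bdd_above A" by (auto simp: A_def bdd_above_def)
  show False
  \<comment> \<open>\<open>M\<close> may have an atom at \<open>Sup A\<close>. If
    \<open>Sup A\<close> is in \<open>A\<close>, it is itself the contradictory point. Otherwise
    \<open>A\<close> lies in \<open>{..<Sup A}\<close>, whose mass is the left limit of
    \<open>cdf M\<close>, and a point of \<open>A\<close> close to \<open>Sup A\<close>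
    serves.\<close>
  proof (cases "Sup A \<in> A")
    case True
    have "measure M A \<le> cdf M (Sup A)"
      unfolding cdf_def using bdd by (intro M.finite_measure_mono) (auto intro: cSup_upper)
    then show False using A gap[OF True] \<open>0 < e\<close> by simp
  next
    case False
    then have "A \<subseteq> {..<Sup A}"
      using cSup_upper[OF _ bdd] by (force simp: less_le)
    then have "cdf M t \<le> measure M {..<Sup A}"
      unfolding A[symmetric] by (intro M.finite_measure_mono) auto
    then have "cdf M t - e < measure M {..<Sup A}"
      using \<open>0 < e\<close> by simp
    from order_tendstoD(1)[OF M.cdf_at_left this]
    obtain b where b: "b < Sup A" "\<And>x. b < x \<Longrightarrow> x < Sup A \<Longrightarrow> cdf M t - e < cdf M x"
      unfolding eventually_at_left_field by blast
    obtain s where s: "s \<in> A" "b < s"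
      using b(1) less_cSup_iff[OF \<open>A \<noteq> {}\<close> bdd] by blast
    with \<open>A \<subseteq> {..<Sup A}\<close> b(2)[of s] gap[OF s(1)] show False by auto
  qed
qed

subsection \<open>The Cramer--von Mises distance\<close>

lemma real_distribution_proj:
  fixes P :: "(real ^ 'd) measure"
  assumes "prob_space P" "sets P = sets borel"
  shows "real_distribution (distr P borel (\<lambda>x. \<beta> \<bullet> x))"
proof -
  have "(\<lambda>x. \<beta> \<bullet> x) \<in> borel_measurable P"
    unfolding measurable_cong_sets[OF assms(2) refl] by measurable
  then show ?thesis
    using assms(1) by (simp add: prob_space.real_distribution_distr)
qed

lemma proj_cdf_eq_integral:
  fixes P :: "(real ^ 'd) measure"
  assumes "prob_space P" "sets P = sets borel"
  shows "proj_cdf P \<beta> t = (LINT x|P. indicator {..t} (\<beta> \<bullet> x))"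
proof -
  have "(\<lambda>x. \<beta> \<bullet> x) \<in> borel_measurable P"
    unfolding measurable_cong_sets[OF assms(2) refl] by measurable
  then show ?thesis
    unfolding proj_cdf_def cdf_def by (subst integral_distr[symmetric]) auto
qed

text \<open>Written as an integral over the fixed law \<open>P\<close>, the distribution function
  has direction and threshold only in a jointly measurable integrand.\<close>

lemma borel_measurable_proj_cdf:
  fixes P :: "(real ^ 'd) measure"
  assumes P: "prob_space P" "sets P = sets borel"
  shows "(\<lambda>(\<beta>, t). proj_cdf P \<beta> t) \<in> borel_measurable (borel \<Otimes>\<^sub>M borel)"
proof -
  interpret prob_space P by fact
  note P(2)[measurable_cong]
  have "(\<lambda>(z, x). indicator {y. y \<le> snd z} (fst z \<bullet> x) :: real) \<in>
      borel_measurable ((borel \<Otimes>\<^sub>M borel) \<Otimes>\<^sub>M P)"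
    unfolding indicator_def by measurable
  then have "(\<lambda>z. LINT x|P. indicator {y. y \<le> snd z} (fst z \<bullet> x) :: real) \<in>
      borel_measurable (borel \<Otimes>\<^sub>M borel)"
    by (rule borel_measurable_lebesgue_integral)
  then show ?thesis
    by (simp add: proj_cdf_eq_integral[OF P] split_beta' atMost_def)
qed

section \<open>The mixture measure, measurability and integrability\<close>

context
  fixes P Q :: "(real ^ 'd) measure" and \<theta> :: real
  assumes P: "prob_space P" "sets P = sets borel"
    and Q: "prob_space Q" "sets Q = sets borel"
    and \<theta>: "0 < \<theta>" "\<theta> < 1"
begin

text \<open>A convex combination of distribution functions inherits monotonicity, right continuity
  and the limits 0 and 1, so \<open>interval_measure\<close> yields the intended probability
  measure.\<close>

lemma interval_measure_mixed_cdf: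
  shows real_distribution_mixed: "real_distribution (interval_measure (mixed_cdf \<theta> P Q \<beta>))"
    and cdf_mixed: "cdf (interval_measure (mixed_cdf \<theta> P Q \<beta>)) = mixed_cdf \<theta> P Q \<beta>"
proof -
  interpret P: real_distribution "distr P borel (\<lambda>x. \<beta> \<bullet> x)"
    using P by (rule real_distribution_proj)
  interpret Q: real_distribution "distr Q borel (\<lambda>x. \<beta> \<bullet> x)"
    using Q by (rule real_distribution_proj)
  have eq: "mixed_cdf \<theta> P Q \<beta> = (\<lambda>t. \<theta> * cdf (distr P borel (\<lambda>x. \<beta> \<bullet> x)) t
      + (1 - \<theta>) * cdf (distr Q borel (\<lambda>x. \<beta> \<bullet> x)) t)"
    by (simp add: fun_eq_iff mixed_cdf_def proj_cdf_def)
  have mono: "mixed_cdf \<theta> P Q \<beta> x \<le> mixed_cdf \<theta> P Q \<beta> y" if "x \<le> y" for x y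
    unfolding eq using that \<theta>
    by (intro add_mono mult_left_mono P.cdf_nondecreasing Q.cdf_nondecreasing) auto
  have cont: "continuous (at_right a) (mixed_cdf \<theta> P Q \<beta>)" for a
    unfolding eq by (intro continuous_intros P.cdf_is_right_cont Q.cdf_is_right_cont)
  have bot: "(mixed_cdf \<theta> P Q \<beta> \<longlongrightarrow> 0) at_bot"
    unfolding eq using tendsto_add[OF tendsto_mult_left[OF P.cdf_lim_at_bot, of \<theta>]
      tendsto_mult_left[OF Q.cdf_lim_at_bot, of "1 - \<theta>"]] by simp
  have top: "(mixed_cdf \<theta> P Q \<beta> \<longlongrightarrow> 1) at_top"
    unfolding eq using tendsto_add[OF tendsto_mult_left[OF P.cdf_lim_at_top_prob, of \<theta>]
      tendsto_mult_left[OF Q.cdf_lim_at_top_prob, of "1 - \<theta>"]] by simp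
  show "real_distribution (interval_measure (mixed_cdf \<theta> P Q \<beta>))"
    using mono cont bot top by (rule real_distribution_interval_measure)
  show "cdf (interval_measure (mixed_cdf \<theta> P Q \<beta>)) = mixed_cdf \<theta> P Q \<beta>"
    using mono cont bot by (rule cdf_interval_measure)
qed

text \<open>Makes the integrating measure a probability kernel in the direction, as measurability of
  the inner integral demands. Half-lines suffice as test sets, and their mass is
  \<open>mixed_cdf \<theta> P Q \<beta> t\<close>.\<close>

lemma measurable_interval_measure_mixed_cdf:
  "(\<lambda>\<beta>. interval_measure (mixed_cdf \<theta> P Q \<beta>)) \<in> borel \<rightarrow>\<^sub>M prob_algebra borel"
proof (rule measurable_prob_algebra_generated[of _ UNIV "range atMost"])
  show "sets borel = sigma_sets UNIV (range (atMost :: real \<Rightarrow> _))"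
    by (simp add: borel_eq_atMost)
  show "Int_stable (range (atMost :: real \<Rightarrow> _))"
    by (auto simp: Int_stable_def)
  show "prob_space (interval_measure (mixed_cdf \<theta> P Q \<beta>))" for \<beta>
    using real_distribution_mixed by (simp add: real_distribution_def)
  fix A :: "real set" assume "A \<in> range atMost"
  then obtain t where t: "A = {..t}" by auto
  have "emeasure (interval_measure (mixed_cdf \<theta> P Q \<beta>)) A = ennreal (mixed_cdf \<theta> P Q \<beta> t)" for \<beta>
  proof -
    interpret real_distribution "interval_measure (mixed_cdf \<theta> P Q \<beta>)"
      by (rule real_distribution_mixed)
    show ?thesis
      using cdf_mixed[of \<beta>] by (simp add: t emeasure_eq_measure cdf_def fun_eq_iff)
  qed
  moreover have "(\<lambda>\<beta>. mixed_cdf \<theta> P Q \<beta> t) \<in> borel_measurable borel"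
  proof -
    have "(\<lambda>\<beta>. proj_cdf R \<beta> t) \<in> borel_measurable borel"
      if "prob_space R" "sets R = sets borel" for R :: "(real ^ 'd) measure"
      using measurable_compose[OF measurable_Pair2'[of t borel borel] borel_measurable_proj_cdf[OF that]]
      by simp
    with P Q show ?thesis unfolding mixed_cdf_def by simp
  qed
  ultimately show "(\<lambda>\<beta>. emeasure (interval_measure (mixed_cdf \<theta> P Q \<beta>)) A) \<in> borel_measurable borel"
    by simp
qed simp_all

lemma proj_cdf_diff_square_le_1: "(proj_cdf P \<beta> t - proj_cdf Q \<beta> t)\<^sup>2 \<le> 1"
proof -
  interpret P: real_distribution "distr P borel (\<lambda>x. \<beta> \<bullet> x)"
    using P by (rule real_distribution_proj)
  interpret Q: real_distribution "distr Q borel (\<lambda>x. \<beta> \<bullet> x)"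
    using Q by (rule real_distribution_proj)
  have "\<bar>proj_cdf P \<beta> t - proj_cdf Q \<beta> t\<bar> \<le> 1"
    using P.cdf_nonneg[of t] Q.cdf_nonneg[of t] P.cdf_bounded_prob[of t] Q.cdf_bounded_prob[of t]
    unfolding proj_cdf_def by linarith
  then show ?thesis by (simp add: abs_square_le_1)
qed

lemma borel_measurable_proj_cdf_diff_square:
  "(\<lambda>(\<beta>, t). (proj_cdf P \<beta> t - proj_cdf Q \<beta> t)\<^sup>2) \<in> borel_measurable (borel \<Otimes>\<^sub>M borel)"
  using borel_measurable_proj_cdf[OF P] borel_measurable_proj_cdf[OF Q]
  unfolding split_beta' by measurable

text \<open>The integral of a nonintegrable function is 0 by default, so a vanishing integral is
  informative only together with integrability. The same holds for the outer integral.\<close>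

lemma integrable_proj_cdf_diff_square:
  "integrable (interval_measure (mixed_cdf \<theta> P Q \<beta>)) (\<lambda>t. (proj_cdf P \<beta> t - proj_cdf Q \<beta> t)\<^sup>2)"
proof -
  interpret real_distribution "interval_measure (mixed_cdf \<theta> P Q \<beta>)"
    by (rule real_distribution_mixed)
  have "(\<lambda>t. (proj_cdf P \<beta> t - proj_cdf Q \<beta> t)\<^sup>2) \<in> borel_measurable borel"
    using measurable_compose[OF measurable_Pair1'[of \<beta> borel borel]
        borel_measurable_proj_cdf_diff_square] by simp
  then show ?thesis
    using proj_cdf_diff_square_le_1 by (intro integrable_const_bound[of _ 1]) auto
qed

lemma integrable_cvm_integrand:
  "integrable sphere_uniform (\<lambda>\<beta>. LINT t|interval_measure (mixed_cdf \<theta> P Q \<beta>).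
     (proj_cdf P \<beta> t - proj_cdf Q \<beta> t)\<^sup>2)" (is "integrable _ ?I")
proof -
  interpret S: prob_space "sphere_uniform :: (real ^ 'd) measure"
    by (rule prob_space_sphere_uniform)
  \<comment> \<open>Measurability in \<open>\<beta>\<close> is obtained for the nonnegative integral
    against the kernel and carried over by \<open>enn2real\<close>.\<close>
  have "(\<lambda>(\<beta>, t). ennreal ((proj_cdf P \<beta> t - proj_cdf Q \<beta> t)\<^sup>2)) \<in> borel_measurable (borel \<Otimes>\<^sub>M borel)"
    using borel_measurable_proj_cdf_diff_square unfolding split_beta' by measurable
  from nn_integral_measurable_subprob_algebra2[OF this
      measurable_prob_algebraD[OF measurable_interval_measure_mixed_cdf]]
  have "(\<lambda>\<beta>. enn2real (\<integral>\<^sup>+ t. ennreal ((proj_cdf P \<beta> t - proj_cdf Q \<beta> t)\<^sup>2)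
      \<partial>interval_measure (mixed_cdf \<theta> P Q \<beta>))) \<in> borel_measurable borel"
    by measurable
  then have "?I \<in> borel_measurable borel"
    using integral_eq_nn_integral[OF borel_measurable_integrable[OF integrable_proj_cdf_diff_square]]
    by simp
  then have "?I \<in> borel_measurable sphere_uniform"
    unfolding measurable_cong_sets[OF sets_sphere_uniform refl] by (rule measurable_restrict_space1)
  moreover have "\<bar>?I \<beta>\<bar> \<le> 1" for \<beta>
  proof -
    interpret real_distribution "interval_measure (mixed_cdf \<theta> P Q \<beta>)"
      by (rule real_distribution_mixed)
    have "?I \<beta> \<le> 1"
      using integral_mono[OF integrable_proj_cdf_diff_square integrable_const
          proj_cdf_diff_square_le_1] prob_space by simp
    then show ?thesis by simp
  qed
  ultimately show ?thesis
    by (intro S.integrable_const_bound[of _ 1]) auto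
qed

text \<open>A nonnegative integrable function with integral 0 vanishes almost everywhere; this is
  applied to the outer and then to the inner integral.\<close>

lemma cvm_distance_eq_0_imp_eq:
  assumes "cvm_distance \<theta> P Q = 0"
  shows "P = Q"
proof (rule Cramer_Wold_AE[OF P Q])
  have "AE \<beta> in sphere_uniform. (LINT t|interval_measure (mixed_cdf \<theta> P Q \<beta>).
     (proj_cdf P \<beta> t - proj_cdf Q \<beta> t)\<^sup>2) = 0"
    using assms integral_nonneg_eq_0_iff_AE[OF integrable_cvm_integrand]
    by (simp add: cvm_distance_def)
  then show "AE \<beta> in sphere_uniform. distr P borel (\<lambda>x. \<beta> \<bullet> x) = distr Q borel (\<lambda>x. \<beta> \<bullet> x)"
  proof eventually_elim
    case (elim \<beta>)
    then have "AE t in interval_measure (mixed_cdf \<theta> P Q \<beta>). proj_cdf P \<beta> t = proj_cdf Q \<beta> t"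
      using integral_nonneg_eq_0_iff_AE[OF integrable_proj_cdf_diff_square] by simp
    with real_distribution_mixed \<theta>
    have "cdf (distr P borel (\<lambda>x. \<beta> \<bullet> x)) = cdf (distr Q borel (\<lambda>x. \<beta> \<bullet> x))"
      by (intro cdf_eq_if_AE_mixture[OF real_distribution_proj[OF P] real_distribution_proj[OF Q]])
        (auto simp: cdf_mixed mixed_cdf_def proj_cdf_def)
    then show ?case
      by (intro cdf_unique real_distribution_proj P Q)
  qed
qed

end

theorem lemma2p1:
  fixes P\<^sub>X P\<^sub>Y :: "(real ^ 'd) measure" and \<theta> :: real
  assumes "0 < \<theta>" and "\<theta> < 1"
    and "prob_space P\<^sub>X" and "sets P\<^sub>X = sets borel"
    and "prob_space P\<^sub>Y" and "sets P\<^sub>Y = sets borel"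
  shows "0 \<le> cvm_distance \<theta> P\<^sub>X P\<^sub>Y \<and> (cvm_distance \<theta> P\<^sub>X P\<^sub>Y = 0 \<longleftrightarrow> P\<^sub>X = P\<^sub>Y)"
proof (intro conjI iffI)
  \<comment> \<open>\<open>sqrt\<close> is negative on negative reals, so the sign comes from the
    integrand being a square.\<close>
  show "0 \<le> cvm_distance \<theta> P\<^sub>X P\<^sub>Y"
    by (simp add: cvm_distance_def)
  show "P\<^sub>X = P\<^sub>Y" if "cvm_distance \<theta> P\<^sub>X P\<^sub>Y = 0"
    using assms that by (intro cvm_distance_eq_0_imp_eq)
  show "cvm_distance \<theta> P\<^sub>X P\<^sub>Y = 0" if "P\<^sub>X = P\<^sub>Y"
    using that by (simp add: cvm_distance_def)
qed

end
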